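(* Let $(\mathscr{S},\mathscr{A})$, $\mathscr{A}=(A_\alpha)_{\alpha\in\Lambda}$, be an average scheme on a norming dual pair $(X,Y)$. Then the following are equivalent: (i) The average scheme $(\mathscr{S},\mathscr{A})$ is weakly ergodic. (ii) For every $x\in X$ the net $(A_\alpha x)_{\alpha\in\Lambda}$ clusters in $(X,\sigma)$ and for every $y\in Y$ the net $(A'_\alpha y)_{\alpha\in\Lambda}$ clusters in $(Y,\sigma')$. If these equivalent conditions are satisfied, then: (iii) The fixed spaces $\mathrm{fix}(\mathscr{S})$ and $\mathrm{fix}(\mathscr{S}')$ separate each other. (iv) $X=\mathrm{fix}(\mathscr{S})\oplus\overline{\mathrm{span}}^{\sigma}\,\mathrm{rg}(I-\mathscr{S})$ and $Y=\mathrm{fix}(\mathscr{S}')\oplus\overline{\mathrm{span}}^{\sigma'}\,\mathrm{rg}(I-\mathscr{S}')$. (v) The operator $P$ defined by $Px:=\sigma\text{-}\lim_\alpha A_\alpha x$ belongs to $\mathscr{L}(X,\sigma)$, and its $\sigma$-adjoint $P'$ is given by $P'y=\sigma'\text{-}\lim_\alpha A'_\alpha y$ for all $y\in Y$. Moreover, $P$ is the projection onto $\mathrm{fix}(\mathscr{S})$ along $\overline{\mathrm{span}}^{\sigma}\,\mathrm{rg}(I-\mathscr{S})$, $P'$ is the projection onto $\mathrm{fix}(\mathscr{S}')$ along $\overline{\mathrm{span}}^{\sigma'}\,\mathrm{rg}(I-\mathscr{S}')$, and $PS=SP=P$ for all $S\in\mathscr{S}$.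
   Context: A norming dual pair $(X,Y)$ consists of Banach spaces $X,Y$ (over the same scalar field) and a bilinear duality $\langle\cdot,\cdot\rangle$ between $X$ and $Y$ with $\|x\|=\sup\{|\langle x,y\rangle|: y\in Y,\|y\|\le1\}$ for all $x\in X$ and $\|y\|=\sup\{|\langle x,y\rangle|: x\in X,\|x\|\le1\}$ for all $y\in Y$. Write $\sigma$ for the weak topology $\sigma(X,Y)$ on $X$ and $\sigma'$ for the weak topology $\sigma(Y,X)$ on $Y$. $\mathscr{L}(X,\sigma)$ is the algebra of $\sigma$-continuous linear operators on $X$; such operators are norm-bounded, and $S\in\mathscr{L}(X,\sigma)$ has a $\sigma$-adjoint $S'$ on $Y$ given by $\langle Sx,y\rangle=\langle x,S'y\rangle$. For a family $\mathscr{S}$ of linear operators on a vector space $X$: $\mathrm{fix}(\mathscr{S}):=\bigcap_{S\in\mathscr{S}}\ker(I-S)$, $\mathrm{rg}(I-\mathscr{S}):=\{x-Sx: x\in X, S\in\mathscr{S}\}$, and $\mathrm{co}(\mathscr{S}x)$ is the convex hull of the orbit $\{Sx:S\in\mathscr{S}\}$. $\overline{\mathrm{span}}^{\tau}$ denotes the $\tau$-closure of the linear span and $\overline{\mathrm{co}}^{\tau}$ the $\tau$-closure of the convex hull. A family $\mathscr{S}$ containing the identity is a semigroup if $ST\in\mathscr{S}$ for all $S,T\in\mathscr{S}$. An average scheme on $(X,Y)$ is a pair $(\mathscr{S},\mathscr{A})$, where $\mathscr{S}\subset\mathscr{L}(X,\sigma)$ is a semigroup with adjoint $\mathscr{S}':=\{S':S\in\mathscr{S}\}$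 and $\mathscr{A}=(A_\alpha)_{\alpha\in\Lambda}\subset\mathscr{L}(X,\sigma)$ is a net such that: (AS1) there is $M>0$ with $\|A_\alpha\|\le M$ for all $\alpha\in\Lambda$; (AS2) $A_\alpha x\in\overline{\mathrm{co}}^{\sigma}(\mathscr{S}x)$ and $A'_\alpha y\in\overline{\mathrm{co}}^{\sigma'}(\mathscr{S}'y)$ for all $\alpha\in\Lambda$, $x\in X$, $y\in Y$; (AS3) for every $S\in\mathscr{S}$, $x\in X$, $y\in Y$: $\lim_\alpha A_\alpha(S-I)x=\lim_\alpha(S-I)A_\alpha x=0$ and $\lim_\alpha A'_\alpha(S'-I)y=\lim_\alpha(S'-I)A'_\alpha y=0$ in the norms of $X$ and $Y$ respectively. The average scheme is weakly ergodic if $\sigma\text{-}\lim_\alpha A_\alpha x$ exists for every $x\in X$ and $\sigma'\text{-}\lim_\alpha A'_\alpha y$ exists for every $y\in Y$. A net in a topological space clusters if every subnet of it has a cluster point, i.e. has a convergent subnet. $\mathrm{fix}(\mathscr{S})$ separates $\mathrm{fix}(\mathscr{S}')$ if for every $0\ne y\in\mathrm{fix}(\mathscr{S}')$ there is $x\in\mathrm{fix}(\mathscr{S})$ with $\langle x,y\rangle\neq0$; the reverse notion is defined by interchanging roles. *)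

theory Defs
  imports "HOL-Analysis.Analysis"
begin

section \<open>Nets\<close>

definition directed_set :: "'i set \<Rightarrow> ('i \<Rightarrow> 'i \<Rightarrow> bool) \<Rightarrow> bool" where
  "directed_set \<Lambda> le \<longleftrightarrow> \<Lambda> \<noteq> {} \<and> reflp_on \<Lambda> le \<and> transp_on \<Lambda> le \<and>
     (\<forall>a\<in>\<Lambda>. \<forall>b\<in>\<Lambda>. \<exists>c\<in>\<Lambda>. le a c \<and> le b c)"

text \<open>The filter of tails. A net indexed by a directed set converges in the usual sense iff it
  converges along this filter.\<close>

definition tails :: "'i set \<Rightarrow> ('i \<Rightarrow> 'i \<Rightarrow> bool) \<Rightarrow> 'i filter" where
  "tails \<Lambda> le = (INF a\<in>\<Lambda>. principal {c\<in>\<Lambda>. le a c})"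

lemma eventually_tails:
  assumes "directed_set \<Lambda> le"
  shows "eventually P (tails \<Lambda> le) \<longleftrightarrow> (\<exists>a\<in>\<Lambda>. \<forall>c\<in>\<Lambda>. le a c \<longrightarrow> P c)"
proof -
  have "eventually P (tails \<Lambda> le) \<longleftrightarrow> (\<exists>a\<in>\<Lambda>. eventually P (principal {c\<in>\<Lambda>. le a c}))"
    unfolding tails_def
  proof (rule eventually_INF_base)
    show "\<Lambda> \<noteq> {}" using assms by (simp add: directed_set_def)
    fix a b assume ab: "a \<in> \<Lambda>" "b \<in> \<Lambda>"
    then obtain c where c: "c \<in> \<Lambda>" "le a c" "le b c"
      using assms unfolding directed_set_def by blast
    have "{d\<in>\<Lambda>. le c d} \<subseteq> {d\<in>\<Lambda>. le a d} \<inter> {d\<in>\<Lambda>. le b d}"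
      using assms ab c unfolding directed_set_def transp_on_def by blast
    then show "\<exists>x\<in>\<Lambda>. principal {c\<in>\<Lambda>. le x c}
        \<le> inf (principal {c\<in>\<Lambda>. le a c}) (principal {c\<in>\<Lambda>. le b c})"
      using c(1) by (intro bexI[of _ c]) simp_all
  qed
  then show ?thesis by (auto simp: eventually_principal)
qed

text \<open>Subnets in the sense of Kelley: \<open>h\<close> is the reindexing map.\<close>

definition subnet_map ::
    "'j set \<Rightarrow> ('j \<Rightarrow> 'j \<Rightarrow> bool) \<Rightarrow> 'i set \<Rightarrow> ('i \<Rightarrow> 'i \<Rightarrow> bool) \<Rightarrow> ('j \<Rightarrow> 'i) \<Rightarrow> bool" where
  "subnet_map M leM \<Lambda> le h \<longleftrightarrow> directed_set M leM \<and> h ` M \<subseteq> \<Lambda> \<and>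
     (\<forall>a\<in>\<Lambda>. \<exists>m\<in>M. \<forall>n\<in>M. leM m n \<longrightarrow> le a (h n))"

definition cluster_point ::
    "'a topology \<Rightarrow> 'i set \<Rightarrow> ('i \<Rightarrow> 'i \<Rightarrow> bool) \<Rightarrow> ('i \<Rightarrow> 'a) \<Rightarrow> 'a \<Rightarrow> bool" where
  "cluster_point T \<Lambda> le f l \<longleftrightarrow> l \<in> topspace T \<and>
     (\<forall>U. openin T U \<and> l \<in> U \<longrightarrow> (\<forall>a\<in>\<Lambda>. \<exists>c\<in>\<Lambda>. le a c \<and> f c \<in> U))"

text \<open>HOL cannot quantify over index types inside a formula, so the index sets of the subnets
  are taken inside the type \<open>'i \<times> 'i set\<close>. By the lemma \<open>net_clusters_subnet\<close> below this is no
  restriction: subnets over arbitrary index types then have cluster points as well.\<close>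

definition net_clusters ::
    "'a topology \<Rightarrow> 'i set \<Rightarrow> ('i \<Rightarrow> 'i \<Rightarrow> bool) \<Rightarrow> ('i \<Rightarrow> 'a) \<Rightarrow> bool" where
  "net_clusters T \<Lambda> le f \<longleftrightarrow>
     (\<forall>(M :: ('i \<times> 'i set) set) leM h. subnet_map M leM \<Lambda> le h \<longrightarrow>
        (\<exists>l. cluster_point T M leM (f \<circ> h) l))"

lemma net_clusters_subnet:
  fixes M :: "'j set" and \<Lambda> :: "'i set"
  assumes clus: "net_clusters T \<Lambda> le f" and sub: "subnet_map M leM \<Lambda> le h"
  shows "\<exists>l. cluster_point T M leM (f \<circ> h) l"
proof -
  have dir: "directed_set M leM" and hM: "h ` M \<subseteq> \<Lambda>"
    and cof: "\<And>a. a \<in> \<Lambda> \<Longrightarrow> \<exists>m\<in>M. \<forall>n\<in>M. leM m n \<longrightarrow> le a (h n)"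
    using sub by (auto simp: subnet_map_def)
  define big where "big E \<longleftrightarrow> (\<exists>m\<in>M. \<forall>n\<in>M. leM m n \<longrightarrow> h n \<in> E)" for E
  define N where "N = {(a, E). a \<in> E \<and> a \<in> \<Lambda> \<and> big E}"
  define leN where "leN p q \<longleftrightarrow> snd q \<subseteq> snd p" for p q :: "'i \<times> 'i set"
  have big_ne: "\<exists>n\<in>M. h n \<in> E" if "big E" for E
    using that dir unfolding big_def directed_set_def reflp_on_def by blast
  have big_Int: "big (E \<inter> E')" if E: "big E" "big E'" for E E'
  proof -
    obtain m m' where m: "m \<in> M" "\<And>n. n \<in> M \<Longrightarrow> leM m n \<Longrightarrow> h n \<in> E"
      and m': "m' \<in> M" "\<And>n. n \<in> M \<Longrightarrow> leM m' n \<Longrightarrow> h n \<in> E'"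
      using E unfolding big_def by blast
    obtain k where k: "k \<in> M" "leM m k" "leM m' k"
      using dir m(1) m'(1) unfolding directed_set_def by blast
    have "h n \<in> E \<inter> E'" if "n \<in> M" "leM k n" for n
      using that m m' k dir unfolding directed_set_def transp_on_def by blast
    then show ?thesis unfolding big_def using k(1) by blast
  qed
  have "directed_set N leN"
    unfolding directed_set_def
  proof (intro conjI ballI)
    show "N \<noteq> {}"
    proof -
      have "big UNIV" using dir unfolding big_def directed_set_def by auto
      with big_ne[of UNIV] hM have "\<exists>n\<in>M. (h n, UNIV) \<in> N" unfolding N_def by auto
      then show ?thesis by auto
    qed
    show "reflp_on N leN" "transp_on N leN"
      by (auto simp: leN_def intro!: reflp_onI transp_onI)
    fix p q assume "p \<in> N" "q \<in> N"
    then have "big (snd p \<inter> snd q)" using big_Int by (auto simp: N_def)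
    moreover from this obtain n where "n \<in> M" "h n \<in> snd p \<inter> snd q" using big_ne by blast
    ultimately have "(h n, snd p \<inter> snd q) \<in> N" using hM by (auto simp: N_def)
    then show "\<exists>r\<in>N. leN p r \<and> leN q r" by (intro bexI) (auto simp: leN_def)
  qed
  moreover have "fst ` N \<subseteq> \<Lambda>" by (auto simp: N_def)
  moreover have "\<exists>p\<in>N. \<forall>q\<in>N. leN p q \<longrightarrow> le a (fst q)" if a: "a \<in> \<Lambda>" for a
  proof -
    have "big {c. le a c}" using cof[OF a] by (auto simp: big_def)
    moreover from this obtain n where "n \<in> M" "h n \<in> {c. le a c}" using big_ne by blast
    ultimately have "(h n, {c. le a c}) \<in> N" using hM unfolding N_def by blast
    moreover have "\<forall>q\<in>N. leN (h n, {c. le a c}) q \<longrightarrow> le a (fst q)"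
      by (auto simp: leN_def N_def)
    ultimately show ?thesis by blast
  qed
  ultimately have "subnet_map N leN \<Lambda> le fst" by (auto simp: subnet_map_def)
  then obtain l where l: "cluster_point T N leN (f \<circ> fst) l"
    using clus unfolding net_clusters_def by blast
  have "cluster_point T M leM (f \<circ> h) l"
    unfolding cluster_point_def
  proof (intro conjI allI impI ballI)
    show "l \<in> topspace T" using l by (simp add: cluster_point_def)
    fix U m assume U: "openin T U \<and> l \<in> U" and m: "m \<in> M"
    let ?E = "h ` {n\<in>M. leM m n}"
    have "big ?E" using m by (auto simp: big_def)
    moreover from this obtain n where "n \<in> M" "h n \<in> ?E" using big_ne by blast
    ultimately have "(h n, ?E) \<in> N" using hM unfolding N_def by blast
    moreover have "\<forall>p\<in>N. \<exists>q\<in>N. leN p q \<and> (f \<circ> fst) q \<in> U"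
      using l U unfolding cluster_point_def by blast
    ultimately obtain q where q: "q \<in> N" "leN (h n, ?E) q" "f (fst q) \<in> U"
      unfolding comp_apply by blast
    then have "fst q \<in> ?E" by (auto simp: N_def leN_def)
    then show "\<exists>c\<in>M. leM m c \<and> (f \<circ> h) c \<in> U" using q(3) by auto
  qed
  then show ?thesis ..
qed


section \<open>Norming dual pairs\<close>

text \<open>A Banach space over a scalar field \<open>'k\<close>, where \<open>'k\<close> is \<open>real\<close> or \<open>complex\<close>. The class
  \<open>real_normed_field\<close> covers exactly these two cases: its norm is multiplicative, so by the
  Gelfand--Mazur theorem (Ostrowski) its members are isometrically isomorphic to one of them.
  The class \<open>banach\<close> supplies the norm, completeness and the underlying real scaling.\<close>

locale banach_over = vector_space scale
  for scale :: "'k::real_normed_field \<Rightarrow> 'a::banach \<Rightarrow> 'a" +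
  assumes norm_scale: "norm (scale c x) = norm c * norm x"
    and scale_of_real: "scale (of_real r) x = r *\<^sub>R x"

text \<open>The \<open>bdd_above\<close> conditions say that the suprema are finite; on unbounded sets of reals
  \<open>Sup\<close> is unspecified.\<close>

locale norming_dual_pair = X: banach_over sX + Y: banach_over sY
  for sX :: "'k::real_normed_field \<Rightarrow> 'a::banach \<Rightarrow> 'a"
    and sY :: "'k \<Rightarrow> 'b::banach \<Rightarrow> 'b" +
  fixes dual :: "'a \<Rightarrow> 'b \<Rightarrow> 'k"
  assumes linear_left: "Vector_Spaces.linear sX (*) (\<lambda>x. dual x y)"
    and linear_right: "Vector_Spaces.linear sY (*) (\<lambda>y. dual x y)"
    and bdd_left: "bdd_above ((\<lambda>y. norm (dual x y)) ` {y. norm y \<le> 1})"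
    and norming_left: "norm x = (SUP y\<in>{y. norm y \<le> 1}. norm (dual x y))"
    and bdd_right: "bdd_above ((\<lambda>x. norm (dual x y)) ` {x. norm x \<le> 1})"
    and norming_right: "norm y = (SUP x\<in>{x. norm x \<le> 1}. norm (dual x y))"

text \<open>\<open>weak_topology dual\<close> is \<open>\<sigma>(X, Y)\<close>, and \<open>weak_topology (flip dual)\<close> is \<open>\<sigma>(Y, X)\<close>.\<close>

definition flip :: "('a \<Rightarrow> 'b \<Rightarrow> 'k) \<Rightarrow> 'b \<Rightarrow> 'a \<Rightarrow> 'k" where
  "flip dual y x = dual x y"

definition weak_topology :: "('a \<Rightarrow> 'b \<Rightarrow> 'k::topological_space) \<Rightarrow> 'a topology" where
  "weak_topology dual = topology_generated_by {(\<lambda>x. dual x y) -` U |y U. open U}"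

definition weak_operators ::
    "('k::real_normed_field \<Rightarrow> 'a::banach \<Rightarrow> 'a) \<Rightarrow> ('a \<Rightarrow> 'b \<Rightarrow> 'k) \<Rightarrow> ('a \<Rightarrow> 'a) set" where
  "weak_operators sX dual =
     {S. Vector_Spaces.linear sX sX S \<and> continuous_map (weak_topology dual) (weak_topology dual) S}"

definition weak_adjoint :: "('a \<Rightarrow> 'b \<Rightarrow> 'k) \<Rightarrow> ('a \<Rightarrow> 'a) \<Rightarrow> 'b \<Rightarrow> 'b" where
  "weak_adjoint dual S = (THE T. \<forall>x y. dual (S x) y = dual x (T y))"

definition separates :: "('a \<Rightarrow> 'b::zero \<Rightarrow> 'k::zero) \<Rightarrow> 'a set \<Rightarrow> 'b set \<Rightarrow> bool" where
  "separates dual U V \<longleftrightarrow> (\<forall>y\<in>V. y \<noteq> 0 \<longrightarrow> (\<exists>x\<in>U. dual x y \<noteq> 0))"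


section \<open>Families of operators\<close>

definition operator_semigroup :: "('a \<Rightarrow> 'a) set \<Rightarrow> bool" where
  "operator_semigroup \<S> \<longleftrightarrow> id \<in> \<S> \<and> (\<forall>S\<in>\<S>. \<forall>T\<in>\<S>. S \<circ> T \<in> \<S>)"

definition fix_space :: "('a::ab_group_add \<Rightarrow> 'a) set \<Rightarrow> 'a set" where
  "fix_space \<S> = (\<Inter>S\<in>\<S>. {x. x - S x = 0})"

definition rg_diff :: "('a::ab_group_add \<Rightarrow> 'a) set \<Rightarrow> 'a set" where
  "rg_diff \<S> = {x - S x |x S. S \<in> \<S>}"

definition orbit_of :: "('a \<Rightarrow> 'a) set \<Rightarrow> 'a \<Rightarrow> 'a set" where
  "orbit_of \<S> x = {S x |S. S \<in> \<S>}"

definition direct_sum_space ::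
    "('k::field \<Rightarrow> 'a::ab_group_add \<Rightarrow> 'a) \<Rightarrow> 'a set \<Rightarrow> 'a set \<Rightarrow> bool" where
  "direct_sum_space s U W \<longleftrightarrow> module.subspace s U \<and> module.subspace s W \<and>
     (\<forall>x. \<exists>u\<in>U. \<exists>w\<in>W. x = u + w) \<and> U \<inter> W = {0}"

definition projection_onto_along ::
    "('k::field \<Rightarrow> 'a::ab_group_add \<Rightarrow> 'a) \<Rightarrow> ('a \<Rightarrow> 'a) \<Rightarrow> 'a set \<Rightarrow> 'a set \<Rightarrow> bool" where
  "projection_onto_along s P U W \<longleftrightarrow>
     Vector_Spaces.linear s s P \<and> P \<circ> P = P \<and> range P = U \<and> {x. P x = 0} = W"


section \<open>Average schemes\<close>

text \<open>Only the values \<open>A \<alpha>\<close> with \<open>\<alpha> \<in> \<Lambda>\<close> matter. The operator norm bound \<open>\<parallel>A \<alpha>\<parallel> \<le> M\<close> is written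
  out pointwise.\<close>

locale average_scheme = norming_dual_pair sX sY dual
  for sX :: "'k::real_normed_field \<Rightarrow> 'a::banach \<Rightarrow> 'a"
    and sY :: "'k \<Rightarrow> 'b::banach \<Rightarrow> 'b"
    and dual :: "'a \<Rightarrow> 'b \<Rightarrow> 'k" +
  fixes \<S> :: "('a \<Rightarrow> 'a) set"
    and \<Lambda> :: "'i set" and le :: "'i \<Rightarrow> 'i \<Rightarrow> bool"
    and A :: "'i \<Rightarrow> 'a \<Rightarrow> 'a"
  assumes semigroup: "\<S> \<subseteq> weak_operators sX dual" "operator_semigroup \<S>"
    and net: "directed_set \<Lambda> le" "\<And>\<alpha>. \<alpha> \<in> \<Lambda> \<Longrightarrow> A \<alpha> \<in> weak_operators sX dual"
    and AS1: "\<exists>M>0. \<forall>\<alpha>\<in>\<Lambda>. \<forall>x. norm (A \<alpha> x) \<le> M * norm x"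
    and AS2:
      "\<And>\<alpha> x. \<alpha> \<in> \<Lambda> \<Longrightarrow>
         A \<alpha> x \<in> weak_topology dual closure_of (convex hull (orbit_of \<S> x))"
      "\<And>\<alpha> y. \<alpha> \<in> \<Lambda> \<Longrightarrow>
         weak_adjoint dual (A \<alpha>) y \<in>
           weak_topology (flip dual) closure_of (convex hull (orbit_of (weak_adjoint dual ` \<S>) y))"
    and AS3:
      "\<And>S x. S \<in> \<S> \<Longrightarrow> ((\<lambda>\<alpha>. A \<alpha> (S x - x)) \<longlongrightarrow> 0) (tails \<Lambda> le)"
      "\<And>S x. S \<in> \<S> \<Longrightarrow> ((\<lambda>\<alpha>. S (A \<alpha> x) - A \<alpha> x) \<longlongrightarrow> 0) (tails \<Lambda> le)"
      "\<And>S y. S \<in> \<S> \<Longrightarrow>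
         ((\<lambda>\<alpha>. weak_adjoint dual (A \<alpha>) (weak_adjoint dual S y - y)) \<longlongrightarrow> 0) (tails \<Lambda> le)"
      "\<And>S y. S \<in> \<S> \<Longrightarrow>
         ((\<lambda>\<alpha>. weak_adjoint dual S (weak_adjoint dual (A \<alpha>) y) - weak_adjoint dual (A \<alpha>) y)
           \<longlongrightarrow> 0) (tails \<Lambda> le)"

definition weakly_ergodic ::
    "('a \<Rightarrow> 'b \<Rightarrow> 'k::topological_space) \<Rightarrow> 'i set \<Rightarrow> ('i \<Rightarrow> 'i \<Rightarrow> bool) \<Rightarrow> ('i \<Rightarrow> 'a \<Rightarrow> 'a) \<Rightarrow> bool" where
  "weakly_ergodic dual \<Lambda> le A \<longleftrightarrow>
     (\<forall>x. \<exists>l. limitin (weak_topology dual) (\<lambda>\<alpha>. A \<alpha> x) l (tails \<Lambda> le)) \<and>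
     (\<forall>y. \<exists>l. limitin (weak_topology (flip dual)) (\<lambda>\<alpha>. weak_adjoint dual (A \<alpha>) y) l (tails \<Lambda> le))"

end

theory Submission
  imports Defs
begin

text \<open>Cluster points of \<open>A \<alpha> x\<close> are fixed vectors, and pairing with \<open>y \<in> fix_space \<S>'\<close> is constant
  along orbits, hence along the averages, so every cluster point \<open>l\<close> satisfies
  \<open>dual l y = dual x y\<close>. Thus clustering on one side makes the fixed vectors of that side separate
  those of the other; clustering on both sides leaves only one possible cluster point, to
  which the net must then converge. The scheme is symmetric under \<open>\<S> \<mapsto> \<S>'\<close>, \<open>dual \<mapsto> flip dual\<close>, so
  everything is proved on one side only. The closed span of the range of \<open>I - S\<close> is the kernel of
  the limit \<open>P\<close>, because \<open>x - A \<alpha> x\<close> lies in it.\<close>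

section \<open>Nets\<close>

lemma tails_neq_bot:
  assumes "directed_set \<Lambda> le"
  shows "tails \<Lambda> le \<noteq> bot"
  unfolding trivial_limit_def eventually_tails[OF assms]
  using assms unfolding directed_set_def reflp_on_def by blast

lemma eventually_tails_in:
  assumes "directed_set \<Lambda> le" "\<And>a. a \<in> \<Lambda> \<Longrightarrow> P a"
  shows "eventually P (tails \<Lambda> le)"
  unfolding eventually_tails[OF assms(1)]
  using assms unfolding directed_set_def by blast

lemma limitin_subnet:
  assumes "limitin T f l (tails \<Lambda> le)" "subnet_map M leM \<Lambda> le h" "directed_set \<Lambda> le"
  shows "limitin T (f \<circ> h) l (tails M leM)"
proof -
  have M: "directed_set M leM" and h: "h ` M \<subseteq> \<Lambda>"
    and cof: "\<And>a. a \<in> \<Lambda> \<Longrightarrow> \<exists>m\<in>M. \<forall>n\<in>M. leM m n \<longrightarrow> le a (h n)"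
    using assms(2) by (auto simp: subnet_map_def)
  have "eventually (\<lambda>x. f (h x) \<in> U) (tails M leM)" if U: "openin T U" "l \<in> U" for U
  proof -
    obtain a where a: "a \<in> \<Lambda>" "\<And>c. c \<in> \<Lambda> \<Longrightarrow> le a c \<Longrightarrow> f c \<in> U"
      using limitinD[OF assms(1) U] unfolding eventually_tails[OF assms(3)] by blast
    then show ?thesis
      unfolding eventually_tails[OF M] using cof[OF a(1)] h by blast
  qed
  then show ?thesis using limitin_topspace[OF assms(1)] by (simp add: limitin_def)
qed

lemma limitin_imp_cluster_point:
  assumes "limitin T f l (tails \<Lambda> le)" "directed_set \<Lambda> le"
  shows "cluster_point T \<Lambda> le f l"
  unfolding cluster_point_def
proof (intro conjI allI impI ballI)
  show "l \<in> topspace T" using assms(1) by (rule limitin_topspace)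
  fix U a assume U: "openin T U \<and> l \<in> U" and a: "a \<in> \<Lambda>"
  obtain b where b: "b \<in> \<Lambda>" "\<And>c. c \<in> \<Lambda> \<Longrightarrow> le b c \<Longrightarrow> f c \<in> U"
    using limitinD[OF assms(1), of U] U unfolding eventually_tails[OF assms(2)] by auto
  obtain c where "c \<in> \<Lambda>" "le a c" "le b c"
    using assms(2) a b(1) unfolding directed_set_def by blast
  then show "\<exists>c\<in>\<Lambda>. le a c \<and> f c \<in> U" using b(2) by blast
qed

lemma limitin_imp_net_clusters:
  fixes \<Lambda> :: "'i set"
  assumes "limitin T f l (tails \<Lambda> le)" "directed_set \<Lambda> le"
  shows "net_clusters T \<Lambda> le f"
  unfolding net_clusters_def
proof (intro allI impI exI)
  fix M :: "('i \<times> 'i set) set" and leM h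
  assume sub: "subnet_map M leM \<Lambda> le h"
  then have "directed_set M leM" by (simp add: subnet_map_def)
  with limitin_subnet[OF assms(1) sub assms(2)] show "cluster_point T M leM (f \<circ> h) l"
    by (rule limitin_imp_cluster_point)
qed

lemma net_clusters_imp_cluster_point:
  assumes "net_clusters T \<Lambda> le f" "directed_set \<Lambda> le"
  shows "\<exists>l. cluster_point T \<Lambda> le f l"
proof -
  \<comment> \<open>The net is a subnet of itself. Its index type differs from the one used in
    \<open>net_clusters\<close>, so \<open>net_clusters_subnet\<close> does the transfer.\<close>
  have "subnet_map \<Lambda> le \<Lambda> le id"
    using assms(2) unfolding subnet_map_def by auto
  from net_clusters_subnet[OF assms(1) this] show ?thesis by simp
qed

text \<open>If the net is not eventually in some neighbourhood \<open>U\<close> of \<open>l\<close>,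
  the indices with values outside \<open>U\<close> are cofinal and give a subnet. A cluster point of
  this subnet also clusters the whole net, hence equals \<open>l\<close>; but no member of the
  subnet lies in \<open>U\<close>.\<close>

lemma net_clusters_unique_imp_limitin:
  assumes clus: "net_clusters T \<Lambda> le f" and dir: "directed_set \<Lambda> le"
    and l: "cluster_point T \<Lambda> le f l"
    and uniq: "\<And>l'. cluster_point T \<Lambda> le f l' \<Longrightarrow> l' = l"
  shows "limitin T f l (tails \<Lambda> le)"
  unfolding limitin_def
proof (intro conjI allI impI)
  show "l \<in> topspace T" using l by (simp add: cluster_point_def)
  fix U assume U: "openin T U \<and> l \<in> U"
  show "eventually (\<lambda>x. f x \<in> U) (tails \<Lambda> le)"
  proof (rule ccontr)
    assume "\<not> ?thesis"
    then have out: "\<exists>c\<in>\<Lambda>. le a c \<and> f c \<notin> U" if "a \<in> \<Lambda>" for a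
      using that unfolding eventually_tails[OF dir] by blast
    define M where "M = {c\<in>\<Lambda>. f c \<notin> U}"
    have tr: "le a c" if "a \<in> \<Lambda>" "b \<in> \<Lambda>" "c \<in> \<Lambda>" "le a b" "le b c" for a b c
      using dir that unfolding directed_set_def transp_on_def by blast
    have "directed_set M le"
      unfolding directed_set_def
    proof (intro conjI ballI)
      show "M \<noteq> {}" using dir out unfolding directed_set_def M_def by blast
      show "reflp_on M le" "transp_on M le"
        using dir unfolding directed_set_def M_def reflp_on_def transp_on_def by blast+
      fix a b assume ab: "a \<in> M" "b \<in> M"
      then obtain c where c: "c \<in> \<Lambda>" "le a c" "le b c"
        using dir unfolding directed_set_def M_def by blast
      obtain d where "d \<in> \<Lambda>" "le c d" "f d \<notin> U" using out[OF c(1)] by blast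
      then show "\<exists>c\<in>M. le a c \<and> le b c"
        using tr ab c unfolding M_def by blast
    qed
    moreover have "\<exists>m\<in>M. \<forall>n\<in>M. le m n \<longrightarrow> le a (id n)" if "a \<in> \<Lambda>" for a
    proof -
      obtain m where m: "m \<in> \<Lambda>" "le a m" "f m \<notin> U" using out[OF \<open>a \<in> \<Lambda>\<close>] by blast
      then have "\<forall>n\<in>M. le m n \<longrightarrow> le a (id n)"
        using tr[OF \<open>a \<in> \<Lambda>\<close>] unfolding M_def by simp
      then show ?thesis using m unfolding M_def by blast
    qed
    ultimately have "subnet_map M le \<Lambda> le id"
      unfolding subnet_map_def M_def by auto
    from net_clusters_subnet[OF clus this]
    obtain l' where l': "cluster_point T M le f l'" by auto
    have "cluster_point T \<Lambda> le f l'"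
      unfolding cluster_point_def
    proof (intro conjI allI impI ballI)
      show "l' \<in> topspace T" using l' by (simp add: cluster_point_def)
      fix V a assume V: "openin T V \<and> l' \<in> V" and a: "a \<in> \<Lambda>"
      obtain b where b: "b \<in> \<Lambda>" "le a b" "f b \<notin> U" using out[OF a] by blast
      then obtain c where "c \<in> M" "le b c" "f c \<in> V"
        using l' V unfolding cluster_point_def M_def by blast
      then show "\<exists>c\<in>\<Lambda>. le a c \<and> f c \<in> V"
        using tr a b unfolding M_def by blast
    qed
    then have "cluster_point T M le f l" using uniq l' by simp
    moreover obtain m where "m \<in> M" using \<open>directed_set M le\<close> by (auto simp: directed_set_def)
    ultimately show False using U unfolding cluster_point_def M_def by blast
  qed
qed

text \<open>Disjoint neighbourhoods of \<open>g l\<close> and \<open>c\<close> cannot coexist: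
  \<open>g (f a)\<close> is frequently in the first and eventually in the second. Applied below with
  \<open>g\<close> the pairing with a fixed vector.\<close>

lemma cluster_point_continuous_limit:
  assumes l: "cluster_point T \<Lambda> le f l" and g: "continuous_map T euclidean g"
    and lim: "((\<lambda>a. g (f a)) \<longlongrightarrow> c) (tails \<Lambda> le)" and dir: "directed_set \<Lambda> le"
  shows "g l = (c :: 'c :: t2_space)"
proof (rule ccontr)
  assume "g l \<noteq> c"
  then obtain U V where UV: "open U" "open V" "g l \<in> U" "c \<in> V" "U \<inter> V = {}"
    using hausdorff[OF \<open>g l \<noteq> c\<close>] by metis
  obtain a where a: "a \<in> \<Lambda>" "\<And>b. b \<in> \<Lambda> \<Longrightarrow> le a b \<Longrightarrow> g (f b) \<in> V"
    using topological_tendstoD[OF lim UV(2,4)] unfolding eventually_tails[OF dir] by blast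
  have "openin T {x \<in> topspace T. g x \<in> U}"
    using g UV(1) by (simp add: openin_continuous_map_preimage)
  then obtain b where "b \<in> \<Lambda>" "le a b" "g (f b) \<in> U"
    using l a(1) UV(3) unfolding cluster_point_def by blast
  then show False using a(2) UV(5) by blast
qed


section \<open>The weak topology\<close>

lemma flip_flip [simp]: "flip (flip d) = d"
  by (simp add: flip_def fun_eq_iff)

lemma topspace_weak_topology [simp]: "topspace (weak_topology d) = UNIV"
proof -
  \<comment> \<open>The preimage of the whole scalar field under a single functional already covers
    the space; \<open>undefined\<close> stands for an arbitrary \<open>y\<close>.\<close>
  have "(\<lambda>x. d x undefined) -` UNIV \<in> {(\<lambda>x. d x y) -` U |y U. open U}"
    by blast
  then show ?thesis unfolding weak_topology_def by auto
qed

text \<open>Universal property of the initial topology for the functionals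
  \<open>d _ y\<close>.\<close>

lemma continuous_map_weak_iff:
  "continuous_map T (weak_topology d) f \<longleftrightarrow> (\<forall>y. continuous_map T euclidean (\<lambda>x. d (f x) y))"
proof -
  have "continuous_map T (weak_topology d) f \<longleftrightarrow>
      (\<forall>y U. open U \<longrightarrow> openin T (f -` ((\<lambda>x. d x y) -` U) \<inter> topspace T))"
    using topspace_weak_topology[of d]
    unfolding weak_topology_def continuous_on_generated_topo_iff by auto
  then show ?thesis
    by (simp add: continuous_map_alt vimage_def)
qed

lemma continuous_map_weak: "continuous_map (weak_topology d) euclidean (\<lambda>x. d x y)"
  using continuous_map_id[of "weak_topology d"] unfolding id_def continuous_map_weak_iff ..

lemma limitin_weak_iff:
  "limitin (weak_topology d) f l F \<longleftrightarrow> (\<forall>y. ((\<lambda>i. d (f i) y) \<longlongrightarrow> d l y) F)"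
proof
  assume "limitin (weak_topology d) f l F"
  then show "\<forall>y. ((\<lambda>i. d (f i) y) \<longlongrightarrow> d l y) F"
    using continuous_map_limit[OF continuous_map_weak[of d]] by (auto simp: o_def)
next
  assume lim: "\<forall>y. ((\<lambda>i. d (f i) y) \<longlongrightarrow> d l y) F"
  \<comment> \<open>Induction on how the open set is generated; the assumed scalar limits enter only
    for the subbasic preimages.\<close>
  have "l \<in> U \<longrightarrow> eventually (\<lambda>i. f i \<in> U) F"
    if "generate_topology_on {(\<lambda>x. d x y) -` U |y U. open U} U" for U
    using that
  proof induction
    case (UN K)
    then show ?case by (blast intro: eventually_mono)
  next
    case (Basis s)
    then show ?case using lim by (auto simp: tendsto_def)
  qed (auto elim: eventually_elim2)
  then show "limitin (weak_topology d) f l F"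
    by (auto simp: limitin_def)
       (auto simp: weak_topology_def openin_topology_generated_by_iff)
qed

text \<open>The usual neighbourhood base: intersections are handled by uniting the finite sets and
  taking the smaller radius. The finiteness of \<open>F\<close> is what later makes a weakly
  continuous functional depend on finitely many pairings.\<close>

lemma openin_weak_nhd:
  fixes d :: "'a \<Rightarrow> 'b \<Rightarrow> 'k::metric_space"
  assumes "openin (weak_topology d) U" "x0 \<in> U"
  shows "\<exists>F e. finite F \<and> e > 0 \<and> (\<forall>x. (\<forall>y\<in>F. dist (d x y) (d x0 y) < e) \<longrightarrow> x \<in> U)"
proof -
  have "generate_topology_on {(\<lambda>x. d x y) -` U |y U. open U} U"
    using assms(1) by (simp add: weak_topology_def openin_topology_generated_by_iff)
  then show ?thesis using assms(2)
  proof (induction rule: generate_topology_on.induct)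
    case (Int a b)
    obtain F e where "finite F" "e > 0" "\<And>x. (\<forall>y\<in>F. dist (d x y) (d x0 y) < e) \<Longrightarrow> x \<in> a"
      using Int.IH(1) Int.prems by blast
    moreover obtain G r where
      "finite G" "r > 0" "\<And>x. (\<forall>y\<in>G. dist (d x y) (d x0 y) < r) \<Longrightarrow> x \<in> b"
      using Int.IH(2) Int.prems by blast
    ultimately show ?case by (intro exI[of _ "F \<union> G"] exI[of _ "min e r"]) auto
  next
    case (UN K)
    then obtain k where k: "k \<in> K" "x0 \<in> k" by blast
    show ?case using UN.IH[OF k] k(1) by blast
  next
    case (Basis s)
    then obtain y V where s: "s = (\<lambda>x. d x y) -` V" "open V" by blast
    then obtain e where "e > 0" "\<And>z. dist z (d x0 y) < e \<Longrightarrow> z \<in> V"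
      using Basis(2) unfolding open_dist by auto
    then show ?case by (intro exI[of _ "{y}"] exI[of _ e]) (auto simp: s)
  qed simp
qed


section \<open>Norming dual pairs\<close>

context norming_dual_pair
begin

lemma
  shows dual_add_left: "dual (x + x') y = dual x y + dual x' y"
    and dual_diff_left: "dual (x - x') y = dual x y - dual x' y"
    and dual_scale_left: "dual (sX c x) y = c * dual x y"
    and dual_zero_left [simp]: "dual 0 y = 0"
proof -
  interpret l: Vector_Spaces.linear sX "(*)" "\<lambda>x. dual x y" by (rule linear_left)
  show "dual (x + x') y = dual x y + dual x' y" by (rule l.add)
  show "dual (x - x') y = dual x y - dual x' y" by (rule l.diff)
  show "dual (sX c x) y = c * dual x y" by (rule l.scale)
  show "dual 0 y = 0" by (rule l.zero)
qed

lemma dual_scaleR_left: "dual (r *\<^sub>R x) y = of_real r * dual x y"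
  by (simp add: X.scale_of_real[symmetric] dual_scale_left)

text \<open>Interpreting the locale at the swapped pair yields every one-sided fact for
  \<open>Y\<close> as well.\<close>

lemma swap: "norming_dual_pair sY sX (flip dual)"
proof (intro norming_dual_pair.intro norming_dual_pair_axioms.intro)
  show "banach_over sX" "banach_over sY" by unfold_locales
  show "Vector_Spaces.linear sY (*) (\<lambda>y. flip dual y x)"
    "Vector_Spaces.linear sX (*) (\<lambda>x. flip dual y x)" for x y
    by (simp_all only: flip_def linear_left linear_right)
  show "bdd_above ((\<lambda>x. norm (flip dual y x)) ` {x. norm x \<le> 1})"
    "bdd_above ((\<lambda>y. norm (flip dual y x)) ` {y. norm y \<le> 1})" for x y
    by (simp_all only: flip_def bdd_left bdd_right)
  show "norm y = (SUP x\<in>{x. norm x \<le> 1}. norm (flip dual y x))" for y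
    unfolding flip_def by (rule norming_right)
  show "norm x = (SUP y\<in>{y. norm y \<le> 1}. norm (flip dual y x))" for x
    unfolding flip_def by (rule norming_left)
qed

lemma
  shows dual_add_right: "dual x (y + y') = dual x y + dual x y'"
    and dual_diff_right: "dual x (y - y') = dual x y - dual x y'"
    and dual_scale_right: "dual x (sY c y) = c * dual x y"
    and dual_zero_right [simp]: "dual x 0 = 0"
proof -
  interpret s: norming_dual_pair sY sX "flip dual" by (rule swap)
  show "dual x (y + y') = dual x y + dual x y'" "dual x (y - y') = dual x y - dual x y'"
    "dual x (sY c y) = c * dual x y" "dual x 0 = 0"
    using s.dual_add_left s.dual_diff_left s.dual_scale_left s.dual_zero_left
    by (simp_all add: flip_def)
qed

text \<open>The norm of the difference is a supremum of zeros. Vector identities below are thus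
  checked by pairing.\<close>

lemma dual_eqI:
  assumes "\<And>y. dual x y = dual x' y"
  shows "x = x'"
proof -
  have "norm (x - x') = (SUP y\<in>{y::'b. norm y \<le> 1}. 0 :: real)"
    unfolding norming_left[of "x - x'"] by (simp add: dual_diff_left assms)
  also have "\<dots> = 0" by (rule cSUP_const) (auto intro: exI[of _ 0])
  finally show ?thesis by simp
qed

lemma norm_dual_le: "norm (dual x y) \<le> norm x * norm y"
proof (cases "y = 0")
  case False
  \<comment> \<open>Rescaling \<open>y\<close> to norm one puts it in the ball over which the norm
    of \<open>x\<close> is a supremum.\<close>
  let ?c = "of_real (inverse (norm y)) :: 'k"
  have "norm (sY ?c y) \<le> 1" using False by (simp add: Y.norm_scale norm_inverse)
  then have "norm (dual x (sY ?c y)) \<le> norm x"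
    unfolding norming_left[of x] by (intro cSUP_upper bdd_left) auto
  then show ?thesis using False by (simp add: dual_scale_right norm_mult norm_divide field_simps)
qed simp

lemma norm_right_le:
  assumes "\<And>x. norm x \<le> 1 \<Longrightarrow> norm (dual x y) \<le> C"
  shows "norm y \<le> C"
  unfolding norming_right[of y]
  by (rule cSUP_least) (use assms in \<open>auto intro: exI[of _ 0]\<close>)

lemma tendsto_dual_zero:
  assumes "(f \<longlongrightarrow> 0) F"
  shows "((\<lambda>i. dual (f i) y) \<longlongrightarrow> 0) F"
proof (rule Lim_null_comparison)
  show "eventually (\<lambda>i. norm (dual (f i) y) \<le> norm (f i) * norm y) F"
    by (simp add: norm_dual_le)
  show "((\<lambda>i. norm (f i) * norm y) \<longlongrightarrow> 0) F"
    using tendsto_mult_left_zero[OF tendsto_norm_zero[OF assms]] .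
qed

text \<open>Elimination of one functional at a time: if \<open>dual x0 y0 = 1\<close>, then
  \<open>f - f x0 * dual _ y0\<close> vanishes wherever the functionals of the remaining set do.\<close>

lemma functional_in_span:
  assumes "finite F" "Vector_Spaces.linear sX (*) f"
    and "\<And>x. (\<forall>y\<in>F. dual x y = 0) \<Longrightarrow> f x = 0"
  shows "\<exists>y. \<forall>x. f x = dual x y"
  using assms
proof (induction F arbitrary: f rule: finite_induct)
  case empty
  then show ?case by (auto intro: exI[of _ 0])
next
  case (insert y0 F)
  interpret f: Vector_Spaces.linear sX "(*)" f by (rule insert.prems)
  show ?case
  proof (cases "\<forall>x. (\<forall>y\<in>F. dual x y = 0) \<longrightarrow> dual x y0 = 0")
    case True
    then show ?thesis using insert by auto
  next
    case False
    then obtain x1 where x1: "\<And>y. y \<in> F \<Longrightarrow> dual x1 y = 0" "dual x1 y0 \<noteq> 0" by blast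
    define x0 where "x0 = sX (inverse (dual x1 y0)) x1"
    have x0: "\<And>y. y \<in> F \<Longrightarrow> dual x0 y = 0" "dual x0 y0 = 1"
      using x1 by (simp_all add: x0_def dual_scale_left)
    define g where "g x = f x - f x0 * dual x y0" for x
    have "Vector_Spaces.linear sX (*) g"
      using X.vector_space_axioms linear_left[of y0]
      by (simp add: Vector_Spaces.linear_iff g_def f.add f.scale dual_add_left dual_scale_left
          algebra_simps)
    moreover have "g x = 0" if "\<forall>y\<in>F. dual x y = 0" for x
    proof -
      \<comment> \<open>Subtracting this multiple of \<open>x0\<close> kills the pairing with
        \<open>y0\<close> and leaves those with \<open>F\<close> unchanged, so the hypothesis on
        \<open>insert y0 F\<close> applies.\<close>
      have "f (x - sX (dual x y0) x0) = 0"
        by (rule insert.prems) (use that x0 in \<open>simp add: dual_diff_left dual_scale_left\<close>)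
      then show ?thesis by (simp add: g_def f.diff f.scale)
    qed
    ultimately obtain y where y: "\<And>x. g x = dual x y" using insert.IH by blast
    have "f x = dual x (y + sY (f x0) y0)" for x
      by (simp add: dual_add_right dual_scale_right y[symmetric] g_def)
    then show ?thesis by blast
  qed
qed

text \<open>The dual space of \<open>X\<close> under the weak topology is \<open>Y\<close>:
  continuity at 0 bounds \<open>f\<close> on a neighbourhood cut out by finitely many
  \<open>y\<close>, so \<open>f\<close> vanishes on their common kernel and
  \<open>functional_in_span\<close> applies.\<close>

lemma weak_continuous_functional:
  assumes "Vector_Spaces.linear sX (*) f" "continuous_map (weak_topology dual) euclidean f"
  shows "\<exists>y. \<forall>x. f x = dual x y"
proof -
  interpret f: Vector_Spaces.linear sX "(*)" f by (rule assms)
  have "openin (weak_topology dual) {x \<in> topspace (weak_topology dual). f x \<in> ball 0 1}"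
    by (rule openin_continuous_map_preimage[OF assms(2)]) simp
  moreover have "0 \<in> {x \<in> topspace (weak_topology dual). f x \<in> ball 0 1}" by (simp add: f.zero)
  ultimately have "\<exists>F e. finite F \<and> e > 0 \<and> (\<forall>x. (\<forall>y\<in>F. dist (dual x y) (dual 0 y) < e) \<longrightarrow>
      x \<in> {x \<in> topspace (weak_topology dual). f x \<in> ball 0 1})"
    by (rule openin_weak_nhd)
  then obtain F e where F: "finite F" "e > 0"
    and small: "\<And>x. (\<forall>y\<in>F. norm (dual x y) < e) \<Longrightarrow> norm (f x) < 1"
    by auto
  have "f x = 0" if x: "\<forall>y\<in>F. dual x y = 0" for x
  proof (rule ccontr)
    assume "f x \<noteq> 0"
    \<comment> \<open>The rescaled vector still annihilates \<open>F\<close>, yet \<open>f\<close>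
      takes the value 1 at it.\<close>
    moreover have "norm (f (sX (inverse (f x)) x)) < 1"
      by (rule small) (use x F in \<open>simp add: dual_scale_left\<close>)
    ultimately show False by (simp add: f.scale)
  qed
  then show ?thesis using functional_in_span[OF F(1) assms(1)] by blast
qed

section \<open>Weakly continuous operators and their adjoints\<close>

lemma weak_adjoint_eq:
  assumes "\<And>x y. dual (S x) y = dual x (T y)"
  shows "weak_adjoint dual S = T"
  unfolding weak_adjoint_def
proof (rule the_equality)
  show "\<forall>x y. dual (S x) y = dual x (T y)" using assms by blast
  fix T' assume T': "\<forall>x y. dual (S x) y = dual x (T' y)"
  interpret s: norming_dual_pair sY sX "flip dual" by (rule swap)
  show "T' = T"
    using assms T' by (intro ext s.dual_eqI) (simp add: flip_def)
qed

text \<open>Turns weak continuity into an algebraic condition. Forward, each functional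
  \<open>dual (S _) y\<close> is weakly continuous and hence represented by a vector. Backward,
  linearity of \<open>S\<close> follows because the pairing separates points, and continuity because
  pairing with \<open>S x\<close> is pairing \<open>x\<close> with \<open>T y\<close>.\<close>

lemma weak_operators_iff:
  "S \<in> weak_operators sX dual \<longleftrightarrow> (\<exists>T. \<forall>x y. dual (S x) y = dual x (T y))"
proof
  assume "S \<in> weak_operators sX dual"
  then have lin: "Vector_Spaces.linear sX sX S"
    and cont: "continuous_map (weak_topology dual) (weak_topology dual) S"
    by (auto simp: weak_operators_def)
  have "\<exists>z. \<forall>x. dual (S x) y = dual x z" for y
  proof (rule weak_continuous_functional)
    show "Vector_Spaces.linear sX (*) (\<lambda>x. dual (S x) y)"
      using lin linear_left[of y]
      by (simp add: Vector_Spaces.linear_iff)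
    show "continuous_map (weak_topology dual) euclidean (\<lambda>x. dual (S x) y)"
      using cont by (simp add: continuous_map_weak_iff)
  qed
  then show "\<exists>T. \<forall>x y. dual (S x) y = dual x (T y)" by metis
next
  assume "\<exists>T. \<forall>x y. dual (S x) y = dual x (T y)"
  then obtain T where T: "\<And>x y. dual (S x) y = dual x (T y)" by blast
  have "S (x + x') = S x + S x'" "S (sX c x) = sX c (S x)" for x x' c
    by (rule dual_eqI, simp add: T dual_add_left dual_scale_left)+
  then show "S \<in> weak_operators sX dual"
    using X.vector_space_axioms continuous_map_weak[of dual]
    by (simp add: weak_operators_def Vector_Spaces.linear_iff continuous_map_weak_iff T)
qed

lemma dual_weak_adjoint:
  assumes "S \<in> weak_operators sX dual"
  shows "dual (S x) y = dual x (weak_adjoint dual S y)"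
proof -
  obtain T where T: "\<And>x y. dual (S x) y = dual x (T y)"
    using assms weak_operators_iff by blast
  then show ?thesis using weak_adjoint_eq[of S T] by simp
qed

lemma weak_adjoint_weak_operators:
  assumes "S \<in> weak_operators sX dual"
  shows "weak_adjoint dual S \<in> weak_operators sY (flip dual)"
proof -
  interpret s: norming_dual_pair sY sX "flip dual" by (rule swap)
  show ?thesis unfolding s.weak_operators_iff
    by (intro exI[of _ S]) (simp add: flip_def dual_weak_adjoint assms)
qed

lemma weak_adjoint_weak_adjoint:
  assumes "S \<in> weak_operators sX dual"
  shows "weak_adjoint (flip dual) (weak_adjoint dual S) = S"
proof -
  interpret s: norming_dual_pair sY sX "flip dual" by (rule swap)
  show ?thesis by (rule s.weak_adjoint_eq) (simp add: flip_def dual_weak_adjoint assms)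
qed

end


section \<open>Average schemes\<close>

context average_scheme
begin

abbreviation "\<S>' \<equiv> weak_adjoint dual ` \<S>"
abbreviation "A' \<alpha> \<equiv> weak_adjoint dual (A \<alpha>)"

section \<open>The adjoint scheme\<close>

lemma dual_S: "S \<in> \<S> \<Longrightarrow> dual (S x) y = dual x (weak_adjoint dual S y)"
  using semigroup(1) dual_weak_adjoint by blast

lemma dual_A: "\<alpha> \<in> \<Lambda> \<Longrightarrow> dual (A \<alpha> x) y = dual x (A' \<alpha> y)"
  using net(2) dual_weak_adjoint by blast

lemma adjoint_adjoint_S: "weak_adjoint (flip dual) ` \<S>' = \<S>"
  using semigroup(1) weak_adjoint_weak_adjoint by (force simp: image_iff)

lemma operator_semigroup_adjoint: "operator_semigroup \<S>'"
  unfolding operator_semigroup_def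
proof (intro conjI ballI)
  have "weak_adjoint dual id = id" by (rule weak_adjoint_eq) simp
  then show "id \<in> \<S>'" using semigroup(2) by (force simp: operator_semigroup_def)
  fix S' T' assume "S' \<in> \<S>'" "T' \<in> \<S>'"
  then obtain S T where ST: "S \<in> \<S>" "T \<in> \<S>" "S' = weak_adjoint dual S" "T' = weak_adjoint dual T"
    by blast
  \<comment> \<open>Adjoints reverse the order of composition.\<close>
  then have "weak_adjoint dual (T \<circ> S) = S' \<circ> T'"
    by (intro weak_adjoint_eq) (simp add: dual_S)
  moreover have "T \<circ> S \<in> \<S>" using semigroup(2) ST by (auto simp: operator_semigroup_def)
  ultimately show "S' \<circ> T' \<in> \<S>'" by (metis imageI)
qed

text \<open>The norm on \<open>Y\<close> is a supremum over the unit ball of \<open>X\<close>, so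
  moving \<open>A \<alpha>\<close> across the pairing preserves the constant
  \<open>M\<close>.\<close>

lemma norm_adjoint_bounded: "\<exists>M>0. \<forall>\<alpha>\<in>\<Lambda>. \<forall>y. norm (A' \<alpha> y) \<le> M * norm y"
proof -
  obtain M where M: "M > 0" "\<And>\<alpha> x. \<alpha> \<in> \<Lambda> \<Longrightarrow> norm (A \<alpha> x) \<le> M * norm x" using AS1 by blast
  have "norm (A' \<alpha> y) \<le> M * norm y" if \<alpha>: "\<alpha> \<in> \<Lambda>" for \<alpha> y
  proof (rule norm_right_le)
    fix x :: 'a assume x: "norm x \<le> 1"
    have "norm (dual x (A' \<alpha> y)) \<le> norm (A \<alpha> x) * norm y"
      using norm_dual_le[of "A \<alpha> x" y] by (simp add: dual_A[OF \<alpha>])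
    also have "\<dots> \<le> M * norm y"
    proof (rule mult_right_mono)
      show "norm (A \<alpha> x) \<le> M"
        using M(2)[OF \<alpha>, of x] mult_left_le[OF x, of M] M(1) by linarith
    qed simp
    finally show "norm (dual x (A' \<alpha> y)) \<le> M * norm y" .
  qed
  then show ?thesis using M(1) by blast
qed

text \<open>The axioms are symmetric once double adjoints are identified with the original
  operators; this licenses proving each later fact for \<open>X\<close> only.\<close>

lemma swap_scheme: "average_scheme sY sX (flip dual) \<S>' \<Lambda> le A'"
proof -
  interpret s: norming_dual_pair sY sX "flip dual" by (rule swap)
  have AA: "weak_adjoint (flip dual) (A' \<alpha>) = A \<alpha>" if "\<alpha> \<in> \<Lambda>" for \<alpha>
    using net(2) that weak_adjoint_weak_adjoint by blast
  have SS: "weak_adjoint (flip dual) (weak_adjoint dual S) = S" if "S \<in> \<S>" for S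
    using semigroup(1) that weak_adjoint_weak_adjoint by blast
  \<comment> \<open>Off \<open>\<Lambda>\<close> nothing is assumed about \<open>A \<alpha>\<close>,
    so the double adjoint is replaced inside limits by eventual equality.\<close>
  have ev: "eventually (\<lambda>\<alpha>. weak_adjoint (flip dual) (A' \<alpha>) = A \<alpha>) (tails \<Lambda> le)"
    using net(1) AA by (rule eventually_tails_in)
  show ?thesis
  proof
    show "\<S>' \<subseteq> weak_operators sY (flip dual)"
      using semigroup(1) weak_adjoint_weak_operators by blast
    show "operator_semigroup \<S>'" by (rule operator_semigroup_adjoint)
    show "directed_set \<Lambda> le" by (rule net)
    show "\<And>\<alpha>. \<alpha> \<in> \<Lambda> \<Longrightarrow> A' \<alpha> \<in> weak_operators sY (flip dual)"
      using net(2) weak_adjoint_weak_operators by blast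
    show "\<exists>M>0. \<forall>\<alpha>\<in>\<Lambda>. \<forall>y. norm (A' \<alpha> y) \<le> M * norm y" by (rule norm_adjoint_bounded)
    show "\<And>\<alpha> y. \<alpha> \<in> \<Lambda> \<Longrightarrow>
        A' \<alpha> y \<in> weak_topology (flip dual) closure_of (convex hull (orbit_of \<S>' y))"
      by (rule AS2)
    show "\<And>\<alpha> x. \<alpha> \<in> \<Lambda> \<Longrightarrow> weak_adjoint (flip dual) (A' \<alpha>) x \<in>
        weak_topology (flip (flip dual)) closure_of
          (convex hull (orbit_of (weak_adjoint (flip dual) ` \<S>') x))"
      by (simp only: AA adjoint_adjoint_S flip_flip AS2)
  next
    fix S' y assume "S' \<in> \<S>'"
    then obtain S where S: "S \<in> \<S>" "S' = weak_adjoint dual S" by blast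
    show "((\<lambda>\<alpha>. A' \<alpha> (S' y - y)) \<longlongrightarrow> 0) (tails \<Lambda> le)"
      "((\<lambda>\<alpha>. S' (A' \<alpha> y) - A' \<alpha> y) \<longlongrightarrow> 0) (tails \<Lambda> le)"
      using AS3(3,4) S by simp_all
  next
    fix S' x assume "S' \<in> \<S>'"
    then obtain S where S: "S \<in> \<S>" "S' = weak_adjoint dual S" by blast
    show "((\<lambda>\<alpha>. weak_adjoint (flip dual) (A' \<alpha>) (weak_adjoint (flip dual) S' x - x)) \<longlongrightarrow> 0)
        (tails \<Lambda> le)"
      by (rule Lim_transform_eventually[OF AS3(1)[OF S(1), of x]])
        (use ev in eventually_elim, simp add: S SS)
    show "((\<lambda>\<alpha>. weak_adjoint (flip dual) S' (weak_adjoint (flip dual) (A' \<alpha>) x)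
          - weak_adjoint (flip dual) (A' \<alpha>) x) \<longlongrightarrow> 0) (tails \<Lambda> le)"
      by (rule Lim_transform_eventually[OF AS3(2)[OF S(1), of x]])
        (use ev in eventually_elim, simp add: S SS)
  qed
qed

section \<open>Fixed vectors and invariance under the averages\<close>

lemma S_fix: "x \<in> fix_space \<S> \<Longrightarrow> S \<in> \<S> \<Longrightarrow> S x = x"
  by (auto simp: fix_space_def)

lemma fix_spaceI: "(\<And>S. S \<in> \<S> \<Longrightarrow> S x = x) \<Longrightarrow> x \<in> fix_space \<S>"
  unfolding fix_space_def by simp metis

text \<open>By (AS2), since such a \<open>C\<close> contains the closed convex hull of the
  orbit.\<close>

lemma A_in_closed_convex:
  assumes "\<alpha> \<in> \<Lambda>" "closedin (weak_topology dual) C" "convex C" "\<And>S. S \<in> \<S> \<Longrightarrow> S x \<in> C"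
  shows "A \<alpha> x \<in> C"
proof -
  have "convex hull (orbit_of \<S> x) \<subseteq> C"
    by (rule hull_minimal) (use assms in \<open>auto simp: orbit_of_def\<close>)
  then show ?thesis using AS2(1)[OF assms(1)] closure_of_minimal[OF _ assms(2)] by blast
qed

lemma closedin_dual_eq: "closedin (weak_topology dual) {x. dual x y = c}"
  using closedin_continuous_map_preimage[OF continuous_map_weak[of dual], of "{c}" y] by simp

text \<open>The level set of \<open>dual _ y\<close> through \<open>x\<close> is weakly closed and
  affine, and contains the orbit. This serves both for fixed \<open>x\<close> and for
  \<open>y\<close> fixed by the adjoint semigroup.\<close>

lemma dual_A_eq:
  assumes "\<alpha> \<in> \<Lambda>" "\<And>S. S \<in> \<S> \<Longrightarrow> dual (S x) y = dual x y"
  shows "dual (A \<alpha> x) y = dual x y"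
proof -
  have "convex {z. dual z y = dual x y}"
    by (rule convexI)
      (simp add: dual_add_left dual_scaleR_left distrib_right[symmetric] of_real_add[symmetric]
        del: of_real_add)
  then have "A \<alpha> x \<in> {z. dual z y = dual x y}"
    using assms by (intro A_in_closed_convex closedin_dual_eq) auto
  then show ?thesis by simp
qed

lemma A_fix: "\<alpha> \<in> \<Lambda> \<Longrightarrow> x \<in> fix_space \<S> \<Longrightarrow> A \<alpha> x = x"
  by (rule dual_eqI, rule dual_A_eq) (simp_all add: S_fix)

lemma dual_A_fix_adjoint:
  assumes "\<alpha> \<in> \<Lambda>" "y \<in> fix_space \<S>'"
  shows "dual (A \<alpha> x) y = dual x y"
proof (rule dual_A_eq[OF assms(1)])
  fix S assume "S \<in> \<S>"
  then show "dual (S x) y = dual x y" using assms(2) by (simp add: dual_S fix_space_def)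
qed

section \<open>Cluster points and separation of the fixed spaces\<close>

lemma cluster_point_fix:
  assumes "cluster_point (weak_topology dual) \<Lambda> le (\<lambda>\<alpha>. A \<alpha> x) l"
  shows "l \<in> fix_space \<S>"
proof (rule fix_spaceI, rule dual_eqI)
  fix S y assume S: "S \<in> \<S>"
  \<comment> \<open>Moving \<open>S - I\<close> to the other side leaves a pairing with one vector
    of \<open>Y\<close>, which is weakly continuous; by (AS3) it tends to 0 along the net.\<close>
  have "dual l (weak_adjoint dual S y - y) = 0"
  proof (rule cluster_point_continuous_limit[OF assms continuous_map_weak _ net(1)])
    show "((\<lambda>\<alpha>. dual (A \<alpha> x) (weak_adjoint dual S y - y)) \<longlongrightarrow> 0) (tails \<Lambda> le)"
      using tendsto_dual_zero[OF AS3(2)[OF S, of x], of y] S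
      by (simp add: dual_diff_left dual_diff_right dual_S)
  qed
  then show "dual (S l) y = dual l y" using S by (simp add: dual_diff_right dual_S)
qed

lemma cluster_point_dual_fix_adjoint:
  assumes "cluster_point (weak_topology dual) \<Lambda> le (\<lambda>\<alpha>. A \<alpha> x) l" "y \<in> fix_space \<S>'"
  shows "dual l y = dual x y"
proof (rule cluster_point_continuous_limit[OF assms(1) continuous_map_weak _ net(1)])
  show "((\<lambda>\<alpha>. dual (A \<alpha> x) y) \<longlongrightarrow> dual x y) (tails \<Lambda> le)"
    by (rule tendsto_eventually)
      (use assms(2) net(1) in \<open>auto intro!: eventually_tails_in dual_A_fix_adjoint\<close>)
qed

lemma separates_fix:
  assumes "\<And>x. net_clusters (weak_topology dual) \<Lambda> le (\<lambda>\<alpha>. A \<alpha> x)"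
  shows "separates dual (fix_space \<S>) (fix_space \<S>')"
  unfolding separates_def
proof (intro ballI impI)
  fix y assume y: "y \<in> fix_space \<S>'" "y \<noteq> 0"
  interpret s: norming_dual_pair sY sX "flip dual" by (rule swap)
  obtain x where x: "dual x y \<noteq> 0"
    using s.dual_eqI[of y 0] y(2) by (auto simp: flip_def)
  obtain l where "cluster_point (weak_topology dual) \<Lambda> le (\<lambda>\<alpha>. A \<alpha> x) l"
    using net_clusters_imp_cluster_point[OF assms net(1)] by blast
  then show "\<exists>x\<in>fix_space \<S>. dual x y \<noteq> 0"
    using cluster_point_fix cluster_point_dual_fix_adjoint y(1) x by metis
qed

section \<open>Uniqueness of cluster points and the limit projection\<close>

lemma fix_space_diff: "x \<in> fix_space \<S> \<Longrightarrow> x' \<in> fix_space \<S> \<Longrightarrow> x - x' \<in> fix_space \<S>"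
  by (rule fix_spaceI, rule dual_eqI) (metis S_fix dual_S dual_diff_left)

text \<open>Two cluster points of the same orbit differ by a fixed vector that annihilates
  \<open>fix_space \<S>'\<close>, so they coincide.\<close>

lemma net_clusters_imp_limitin:
  assumes "separates (flip dual) (fix_space \<S>') (fix_space \<S>)"
    and "net_clusters (weak_topology dual) \<Lambda> le (\<lambda>\<alpha>. A \<alpha> x)"
  shows "\<exists>l. limitin (weak_topology dual) (\<lambda>\<alpha>. A \<alpha> x) l (tails \<Lambda> le)"
proof -
  obtain l where l: "cluster_point (weak_topology dual) \<Lambda> le (\<lambda>\<alpha>. A \<alpha> x) l"
    using net_clusters_imp_cluster_point[OF assms(2) net(1)] by blast
  have "l' = l" if l': "cluster_point (weak_topology dual) \<Lambda> le (\<lambda>\<alpha>. A \<alpha> x) l'" for l'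
  proof -
    have "l' - l \<in> fix_space \<S>" using l l' by (intro fix_space_diff cluster_point_fix)
    moreover have "\<forall>y\<in>fix_space \<S>'. dual (l' - l) y = 0"
      using l l' by (simp add: dual_diff_left cluster_point_dual_fix_adjoint)
    ultimately show "l' = l" using assms(1) by (auto simp: separates_def flip_def)
  qed
  then show ?thesis using net_clusters_unique_imp_limitin[OF assms(2) net(1) l] by blast
qed

text \<open>\<open>P'\<close> may be any map satisfying the pairing identity, so the result applies
  to both sides. It makes \<open>P\<close> weakly continuous and the kernel of \<open>P\<close>
  weakly closed, which gives one inclusion between \<open>N\<close> and the kernel.\<close>

lemma projection:
  assumes P: "\<And>x. limitin (weak_topology dual) (\<lambda>\<alpha>. A \<alpha> x) (P x) (tails \<Lambda> le)"
    and P': "\<And>x y. dual (P x) y = dual x (P' y)"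
  defines "N \<equiv> weak_topology dual closure_of (X.span (rg_diff \<S>))"
  shows "projection_onto_along sX P (fix_space \<S>) N"
    and "direct_sum_space sX (fix_space \<S>) N"
    and "S \<in> \<S> \<Longrightarrow> P \<circ> S = P \<and> S \<circ> P = P"
proof -
  have P_op: "P \<in> weak_operators sX dual" using P' weak_operators_iff by blast
  then have linP: "Vector_Spaces.linear sX sX P" by (simp add: weak_operators_def)
  interpret P: Vector_Spaces.linear sX sX P by (rule linP)
  have nb: "tails \<Lambda> le \<noteq> bot" by (rule tails_neq_bot) (rule net)
  have limP: "((\<lambda>\<alpha>. dual (A \<alpha> x) y) \<longlongrightarrow> dual (P x) y) (tails \<Lambda> le)" for x y
    using P by (simp add: limitin_weak_iff)
  have P_fix: "P x \<in> fix_space \<S>" for x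
    using limitin_imp_cluster_point[OF P net(1)] by (rule cluster_point_fix)
  have fix_P: "P x = x" if x: "x \<in> fix_space \<S>" for x
  proof (rule dual_eqI)
    fix y
    have "((\<lambda>\<alpha>. dual (A \<alpha> x) y) \<longlongrightarrow> dual x y) (tails \<Lambda> le)"
      by (rule tendsto_eventually) (use net(1) x in \<open>auto intro!: eventually_tails_in simp: A_fix\<close>)
    then show "dual (P x) y = dual x y" using tendsto_unique[OF nb limP] by blast
  qed
  have PS: "P (S x) = P x" if S: "S \<in> \<S>" for S x
  proof -
    have "P (S x - x) = 0"
    proof (rule dual_eqI)
      fix y
      have "((\<lambda>\<alpha>. dual (A \<alpha> (S x - x)) y) \<longlongrightarrow> dual 0 y) (tails \<Lambda> le)"
        using tendsto_dual_zero[OF AS3(1)[OF S]] by simp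
      then show "dual (P (S x - x)) y = dual 0 y" using tendsto_unique[OF nb limP] by blast
    qed
    then show ?thesis by (simp add: P.diff)
  qed
  then show "S \<in> \<S> \<Longrightarrow> P \<circ> S = P \<and> S \<circ> P = P"
    using S_fix[OF P_fix] by (auto simp: fun_eq_iff)
  have fix_range: "fix_space \<S> = range P"
    using P_fix fix_P by (metis rangeI subsetI subset_antisym image_subsetI)
  have sub_ker: "X.subspace {x. P x = 0}"
    by (auto simp: X.subspace_def P.add P.scale P.zero)
  have "X.span (rg_diff \<S>) \<subseteq> {x. P x = 0}"
    by (rule X.span_minimal[OF _ sub_ker]) (auto simp: rg_diff_def P.diff PS)
  moreover have "closedin (weak_topology dual) {x. P x = 0}"
  proof -
    \<comment> \<open>The adjoint writes the kernel as an intersection of closed level sets.\<close>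
    have "{x. P x = 0} = (\<Inter>y. {x. dual x (P' y) = 0})"
      using P' dual_eqI[of _ 0] by (auto simp: P'[symmetric])
    then show ?thesis using closedin_dual_eq by auto
  qed
  ultimately have N_ker: "N \<subseteq> {x. P x = 0}" unfolding N_def by (rule closure_of_minimal)
  \<comment> \<open>Convex hulls use real scalars, whereas the span is taken over
    \<open>'k\<close>.\<close>
  have span_scaleR: "r *\<^sub>R x \<in> X.span B" if "x \<in> X.span B" for r x B
    using X.span_scale[OF that, of "of_real r"] by (simp add: X.scale_of_real)
  have diff_A: "x - A \<alpha> x \<in> N" if \<alpha>: "\<alpha> \<in> \<Lambda>" for \<alpha> x
  proof -
    have cont: "continuous_map (weak_topology dual) (weak_topology dual) ((-) x)"
      unfolding continuous_map_weak_iff dual_diff_left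
      by (intro allI continuous_map_diff continuous_map_weak) simp
    \<comment> \<open>\<open>x - S x\<close> lies in the range for every \<open>S\<close>, and this
      passes to convex combinations. The weakly continuous map sending \<open>z\<close> to
      \<open>x - z\<close> then carries the closed hull, which contains \<open>A \<alpha> x\<close>,
      into \<open>N\<close>.\<close>
    have "convex hull (orbit_of \<S> x) \<subseteq> {z. x - z \<in> X.span (rg_diff \<S>)}"
    proof (rule hull_minimal)
      show "orbit_of \<S> x \<subseteq> {z. x - z \<in> X.span (rg_diff \<S>)}"
        by (auto simp: orbit_of_def rg_diff_def intro!: X.span_base)
      show "convex {z. x - z \<in> X.span (rg_diff \<S>)}"
      proof (rule convexI)
        fix a b and u v :: real
        assume ab: "a \<in> {z. x - z \<in> X.span (rg_diff \<S>)}" "b \<in> {z. x - z \<in> X.span (rg_diff \<S>)}"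
          and uv: "u + v = 1"
        have "x - (u *\<^sub>R a + v *\<^sub>R b) = u *\<^sub>R (x - a) + v *\<^sub>R (x - b)"
          using scaleR_left_distrib[of u v x] uv by (simp add: scaleR_diff_right)
        then show "u *\<^sub>R a + v *\<^sub>R b \<in> {z. x - z \<in> X.span (rg_diff \<S>)}"
          using ab by (simp add: X.span_add span_scaleR)
      qed
    qed
    then have "(-) x ` (convex hull (orbit_of \<S> x)) \<subseteq> X.span (rg_diff \<S>)" by blast
    then have "weak_topology dual closure_of ((-) x ` (convex hull (orbit_of \<S> x))) \<subseteq> N"
      unfolding N_def by (rule closure_of_mono)
    then show ?thesis
      using continuous_map_image_closure_subset[OF cont] AS2(1)[OF \<alpha>, of x] by blast
  qed
  \<comment> \<open>A weak limit of elements of the closed set \<open>N\<close>; for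
    \<open>P x = 0\<close> it gives the other inclusion.\<close>
  have ker_N: "x - P x \<in> N" for x
  proof (rule limitin_closedin)
    show "limitin (weak_topology dual) (\<lambda>\<alpha>. x - A \<alpha> x) (x - P x) (tails \<Lambda> le)"
      unfolding limitin_weak_iff dual_diff_left by (intro allI tendsto_intros limP)
    show "closedin (weak_topology dual) N" unfolding N_def by (rule closedin_closure_of)
    show "eventually (\<lambda>\<alpha>. x - A \<alpha> x \<in> N) (tails \<Lambda> le)"
      using net(1) diff_A by (rule eventually_tails_in)
    show "tails \<Lambda> le \<noteq> bot" by (rule nb)
  qed
  have N_eq: "{x. P x = 0} = N"
  proof (intro subset_antisym subsetI)
    fix x assume "x \<in> {x. P x = 0}"
    then show "x \<in> N" using ker_N[of x] by simp
  qed (use N_ker in blast)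
  show "projection_onto_along sX P (fix_space \<S>) N"
    unfolding projection_onto_along_def N_eq fix_range
    using linP fix_P[OF P_fix] by (auto simp: fun_eq_iff)
  show "direct_sum_space sX (fix_space \<S>) N"
    unfolding direct_sum_space_def
  proof (intro conjI allI)
    show "X.subspace (fix_space \<S>)"
      unfolding fix_range by (rule P.subspace_image) (rule X.subspace_UNIV)
    \<comment> \<open>No separate argument about closures of subspaces: \<open>N\<close> is the
      kernel of \<open>P\<close>.\<close>
    show "X.subspace N" using sub_ker by (simp add: N_eq)
    show "\<exists>u\<in>fix_space \<S>. \<exists>w\<in>N. x = u + w" for x
      using P_fix[of x] ker_N[of x] by (intro bexI[of _ "P x"] bexI[of _ "x - P x"]) auto
    show "fix_space \<S> \<inter> N = {0}"
      using fix_P N_eq P.zero P_fix[of 0] by auto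
  qed
qed

end

section \<open>Combining a scheme with its adjoint scheme\<close>

theorem theorem4p4:
  fixes sX :: "'k::real_normed_field \<Rightarrow> 'a::banach \<Rightarrow> 'a"
    and sY :: "'k \<Rightarrow> 'b::banach \<Rightarrow> 'b"
    and dual :: "'a \<Rightarrow> 'b \<Rightarrow> 'k"
    and \<S> :: "('a \<Rightarrow> 'a) set"
    and \<Lambda> :: "'i set" and le :: "'i \<Rightarrow> 'i \<Rightarrow> bool"
    and A :: "'i \<Rightarrow> 'a \<Rightarrow> 'a"
  assumes "average_scheme sX sY dual \<S> \<Lambda> le A"
  shows
    "(weakly_ergodic dual \<Lambda> le A \<longleftrightarrow>
        (\<forall>x. net_clusters (weak_topology dual) \<Lambda> le (\<lambda>\<alpha>. A \<alpha> x)) \<and>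
        (\<forall>y. net_clusters (weak_topology (flip dual)) \<Lambda> le (\<lambda>\<alpha>. weak_adjoint dual (A \<alpha>) y)))
     \<and>
     (weakly_ergodic dual \<Lambda> le A \<longrightarrow>
        (let \<S>' = weak_adjoint dual ` \<S>;
             N = weak_topology dual closure_of (module.span sX (rg_diff \<S>));
             N' = weak_topology (flip dual) closure_of (module.span sY (rg_diff \<S>'))
         in
           separates dual (fix_space \<S>) (fix_space \<S>') \<and>
           separates (flip dual) (fix_space \<S>') (fix_space \<S>) \<and>
           direct_sum_space sX (fix_space \<S>) N \<and>
           direct_sum_space sY (fix_space \<S>') N' \<and>
           (\<exists>P. (\<forall>x. limitin (weak_topology dual) (\<lambda>\<alpha>. A \<alpha> x) (P x) (tails \<Lambda> le)) \<and>
                P \<in> weak_operators sX dual \<and>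
                (\<forall>x y. dual (P x) y = dual x (weak_adjoint dual P y)) \<and>
                (\<forall>y. limitin (weak_topology (flip dual)) (\<lambda>\<alpha>. weak_adjoint dual (A \<alpha>) y)
                       (weak_adjoint dual P y) (tails \<Lambda> le)) \<and>
                projection_onto_along sX P (fix_space \<S>) N \<and>
                projection_onto_along sY (weak_adjoint dual P) (fix_space \<S>') N' \<and>
                (\<forall>S\<in>\<S>. P \<circ> S = P \<and> S \<circ> P = P))))"
proof -
  interpret average_scheme sX sY dual \<S> \<Lambda> le A by (rule assms)
  interpret s: average_scheme sY sX "flip dual" \<S>' \<Lambda> le A' by (rule swap_scheme)
  let ?W = "weak_topology dual" and ?W' = "weak_topology (flip dual)"
  let ?clusters = "(\<forall>x. net_clusters ?W \<Lambda> le (\<lambda>\<alpha>. A \<alpha> x)) \<and>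
    (\<forall>y. net_clusters ?W' \<Lambda> le (\<lambda>\<alpha>. A' \<alpha> y))"
  have clusters: ?clusters if "weakly_ergodic dual \<Lambda> le A"
    using that limitin_imp_net_clusters[OF _ net(1)] unfolding weakly_ergodic_def by metis
  \<comment> \<open>The second claim is the first for the adjoint scheme, whose own adjoint
    semigroup is \<open>\<S>\<close> again.\<close>
  have sep: "separates dual (fix_space \<S>) (fix_space \<S>')"
      "separates (flip dual) (fix_space \<S>') (fix_space \<S>)" if ?clusters
    using that separates_fix s.separates_fix by (simp_all add: adjoint_adjoint_S)
  have ergodic: "weakly_ergodic dual \<Lambda> le A" if ?clusters
    unfolding weakly_ergodic_def
    using that sep[OF that] net_clusters_imp_limitin s.net_clusters_imp_limitin
    by (simp add: adjoint_adjoint_S)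
  have main: "\<exists>P. (\<forall>x. limitin ?W (\<lambda>\<alpha>. A \<alpha> x) (P x) (tails \<Lambda> le)) \<and>
      P \<in> weak_operators sX dual \<and>
      (\<forall>x y. dual (P x) y = dual x (weak_adjoint dual P y)) \<and>
      (\<forall>y. limitin ?W' (\<lambda>\<alpha>. A' \<alpha> y) (weak_adjoint dual P y) (tails \<Lambda> le)) \<and>
      projection_onto_along sX P (fix_space \<S>) (?W closure_of X.span (rg_diff \<S>)) \<and>
      projection_onto_along sY (weak_adjoint dual P) (fix_space \<S>')
        (?W' closure_of Y.span (rg_diff \<S>')) \<and>
      direct_sum_space sX (fix_space \<S>) (?W closure_of X.span (rg_diff \<S>)) \<and>
      direct_sum_space sY (fix_space \<S>') (?W' closure_of Y.span (rg_diff \<S>')) \<and>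
      (\<forall>S\<in>\<S>. P \<circ> S = P \<and> S \<circ> P = P)" if erg: "weakly_ergodic dual \<Lambda> le A"
  proof -
    obtain P Q where P: "\<And>x. limitin ?W (\<lambda>\<alpha>. A \<alpha> x) (P x) (tails \<Lambda> le)"
      and Q: "\<And>y. limitin ?W' (\<lambda>\<alpha>. A' \<alpha> y) (Q y) (tails \<Lambda> le)"
      using erg unfolding weakly_ergodic_def by metis
    \<comment> \<open>Both sides are limits of the same scalar net, since
      \<open>dual (A \<alpha> x) y = dual x (A' \<alpha> y)\<close> on \<open>\<Lambda>\<close>. So
      the two limit operators are adjoint to each other.\<close>
    have PQ: "dual (P x) y = dual x (Q y)" for x y
    proof (rule tendsto_unique[OF tails_neq_bot[OF net(1)]])
      show "((\<lambda>\<alpha>. dual (A \<alpha> x) y) \<longlongrightarrow> dual (P x) y) (tails \<Lambda> le)"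
        using P by (simp add: limitin_weak_iff)
      have "((\<lambda>\<alpha>. dual x (A' \<alpha> y)) \<longlongrightarrow> dual x (Q y)) (tails \<Lambda> le)"
        using Q by (simp add: limitin_weak_iff flip_def)
      then show "((\<lambda>\<alpha>. dual (A \<alpha> x) y) \<longlongrightarrow> dual x (Q y)) (tails \<Lambda> le)"
        by (rule Lim_transform_eventually)
          (use net(1) in \<open>auto intro!: eventually_tails_in simp: dual_A\<close>)
    qed
    have adj: "weak_adjoint dual P = Q" using PQ by (rule weak_adjoint_eq)
    \<comment> \<open>The same identity read in the swapped pair: there \<open>P\<close> plays the
      part of the adjoint of \<open>Q\<close>.\<close>
    have QP: "flip dual (Q y) x = flip dual y (P x)" for x y
      by (simp add: flip_def PQ)
    show ?thesis
      using P Q PQ projection[OF P PQ] s.projection[OF Q QP] weak_operators_iff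
      by (intro exI[of _ P]) (auto simp: adj)
  qed
  show ?thesis
    unfolding Let_def
    using clusters ergodic sep[OF clusters] main by (intro conjI impI iffI) blast+
qed

end
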